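(* Let $(\mathcal{P}^{\text{co}}_{\mathcal{E}_t})_{t\ge 0}$ be the sequence of DIPK belief sets on $(\Omega,\mathcal{F})$ defined in the context, with lower and upper probabilities $\underline{P}_{\mathcal{E}_t},\overline{P}_{\mathcal{E}_t}$ and generalized Bayes' conditional lower and upper probabilities $\underline{P}^B_{\mathcal{E}_t},\overline{P}^B_{\mathcal{E}_t}$. Let $t\in\mathbb{N}$ and $A\in\mathcal{F}$. If $$\sum_{E_j\in\mathcal{E}_t}\underline{P}^B_{\mathcal{E}_{t-1}}(A\mid E_j)\left[\beta(n_t)\underline{P}_{\mathcal{E}_{t-1}}(E_j)+(1-\beta(n_t))P^{emp}_t(E_j)\right]\ \ge\ \underline{P}_{\mathcal{E}_{t-1}}(A)$$ and $$\sum_{E_j\in\mathcal{E}_t}\overline{P}^B_{\mathcal{E}_{t-1}}(A\mid E_j)\left[\beta(n_t)\overline{P}_{\mathcal{E}_{t-1}}(E_j)+(1-\beta(n_t))P^{emp}_t(E_j)\right]\ \le\ \overline{P}_{\mathcal{E}_{t-1}}(A),$$ and at least one of these inequalities is strict, then $\mathcal{P}^{\text{co}}_{\mathcal{E}_t}$ DIPK-contracts with respect to $\mathcal{P}^{\text{co}}_{\mathcal{E}_{t-1}}$ for $A$.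
   Context: $\Omega$ is at most countable, $\mathcal{F}=2^\Omega$, $\Delta(\Omega,\mathcal{F})$ is the set of probability measures on $(\Omega,\mathcal{F})$, $X:\Omega\to\mathcal{X}$ is a function, $(x_i)_{i\ge1}$ is a sequence of data points in $X(\Omega)$, $0=n_0<n_1<n_2<\cdots$ are integers, $\beta$ takes values in $[0,1]$, $\mathbb{N}=\{1,2,\dots\}$. DPK update of a measure. At time $t\ge 1$ the data $x_1,\dots,x_{n_t}$ are available. Let $E_1,\dots,E_m$ be the distinct sets among $X^{-1}(x_1),\dots,X^{-1}(x_{n_t})$, $E_{m+1}=\Omega\setminus\bigcup_{j=1}^m E_j$, and $\mathcal{E}_t=\{E_1,\dots,E_{m+1}\}$. If $E_{m+1}\ne\emptyset$, $P^{emp}_t(E_j)=\frac{1}{n_t+1}\#\{i\le n_t: X^{-1}(x_i)=E_j\}$ for $j\le m$ and $P^{emp}_t(E_{m+1})=1-\sum_{j=1}^m P^{emp}_t(E_j)$; if $E_{m+1}=\emptyset$, $P^{emp}_t(E_j)=\frac{1}{n_t}\#\{i\le n_t: X^{-1}(x_i)=E_j\}$ for $j\le m$ and $P^{emp}_t(E_{m+1})=0$. The time-$t$ DPK update of $P_{\mathcal{E}_{t-1}}\in\Delta(\Omega,\mathcal{F})$ is $P_{\mathcal{E}_t}(A)=\sum_{E_j\in\mathcal{E}_t}P_{\mathcal{E}_{t-1}}(A\mid E_j)P_{\mathcal{E}_t}(E_j)$, $A\in\mathcal{F}$, with $P_{\mathcal{E}_t}(E_j)=\beta(n_t)P_{\mathcal{E}_{t-1}}(E_j)+[1-\beta(n_t)]P^{emp}_t(E_j)$.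 Terms with $E_j=\emptyset$ are $0$ in all sums. DIPK. The agent specifies a set $\mathcal{P}\subset\Delta(\Omega,\mathcal{F})$ with lower probability $\underline{P}(A)=\inf_{P\in\mathcal{P}}P(A)$. The initial belief set is $\mathcal{P}^{\text{co}}_{\mathcal{E}_0}=\text{core}(\underline{P})=\{P\in\Delta(\Omega,\mathcal{F}):P(A)\ge\underline{P}(A)\ \forall A\in\mathcal{F}\}$, and $\mathcal{P}_{\mathcal{E}_0}$ is its set of extreme points, assumed finite, with $\mathcal{P}^{\text{co}}_{\mathcal{E}_0}=\text{Conv}(\mathcal{P}_{\mathcal{E}_0})$ and with every $P\in\mathcal{P}_{\mathcal{E}_0}$ positive on all nonempty events. For $t\ge1$, $\mathcal{P}_{\mathcal{E}_t}$ is the set of time-$t$ DPK updates of the elements of $\mathcal{P}_{\mathcal{E}_{t-1}}$, and $\mathcal{P}^{\text{co}}_{\mathcal{E}_t}=\text{Conv}(\mathcal{P}_{\mathcal{E}_t})$ (convex hull). Put $\underline{P}_{\mathcal{E}_t}(A)=\inf_{P\in\mathcal{P}^{\text{co}}_{\mathcal{E}_t}}P(A)$ and $\overline{P}_{\mathcal{E}_t}(A)=\sup_{P\in\mathcal{P}^{\text{co}}_{\mathcal{E}_t}}P(A)=1-\underline{P}_{\mathcal{E}_t}(A^c)$. Generalized Bayes' conditional lower and upper probabilities: $\underline{P}^B_{\mathcal{E}_t}(A\mid E)=\inf_{P\in\mathcal{P}^{\text{co}}_{\mathcal{E}_t}}\frac{P(A\cap E)}{P(E)}$ and $\overline{P}^B_{\mathcal{E}_t}(A\mid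 E)=\sup_{P\in\mathcal{P}^{\text{co}}_{\mathcal{E}_t}}\frac{P(A\cap E)}{P(E)}$. $\mathcal{P}^{\text{co}}_{\mathcal{E}_t}$ DIPK-contracts with respect to $\mathcal{P}^{\text{co}}_{\mathcal{E}_{t-1}}$ for $A$ if $\underline{P}_{\mathcal{E}_t}(A)\ge\underline{P}_{\mathcal{E}_{t-1}}(A)$ and $\overline{P}_{\mathcal{E}_t}(A)\le\overline{P}_{\mathcal{E}_{t-1}}(A)$, with at least one inequality strict. *)

theory Defs
  imports "HOL-Probability.Probability" "HOL-Library.Function_Algebras"
begin

text \<open>
  The sample space is the whole (countable) type \<open>'a\<close>, with every subset an event.
  A probability measure is represented by its set function \<open>'a set \<Rightarrow> real\<close>, and these are
  vectors for the pointwise operations, so that the library's convex hulls and extreme points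
  apply to sets of probability measures.
\<close>

instantiation "fun" :: (type, real_vector) real_vector
begin

definition scaleR_fun_def: "r *\<^sub>R f = (\<lambda>x. r *\<^sub>R f x)"

instance
  by standard (auto simp: scaleR_fun_def fun_eq_iff algebra_simps)

end

definition prob_measures :: "('a set \<Rightarrow> real) set"
  where "prob_measures = {measure M | M. prob_space M \<and> sets M = UNIV}"

definition lower_prob :: "('a set \<Rightarrow> real) set \<Rightarrow> 'a set \<Rightarrow> real"
  where "lower_prob S A = (INF P\<in>S. P A)"

definition upper_prob :: "('a set \<Rightarrow> real) set \<Rightarrow> 'a set \<Rightarrow> real"
  where "upper_prob S A = (SUP P\<in>S. P A)"

definition bayes_lower :: "('a set \<Rightarrow> real) set \<Rightarrow> 'a set \<Rightarrow> 'a set \<Rightarrow> real"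
  where "bayes_lower S A E = (INF P\<in>S. P (A \<inter> E) / P E)"

definition bayes_upper :: "('a set \<Rightarrow> real) set \<Rightarrow> 'a set \<Rightarrow> 'a set \<Rightarrow> real"
  where "bayes_upper S A E = (SUP P\<in>S. P (A \<inter> E) / P E)"

definition core :: "('a set \<Rightarrow> real) \<Rightarrow> ('a set \<Rightarrow> real) set"
  where "core L = {P \<in> prob_measures. \<forall>A. L A \<le> P A}"

text \<open>
  Everything at time \<open>t\<close> depends on \<open>t\<close> only through the number \<open>N\<close> of data points
  \<open>x 1, \<dots>, x N\<close> available then; the value \<open>x 0\<close> is never used.
\<close>

definition data_cells :: "('a \<Rightarrow> 'b) \<Rightarrow> (nat \<Rightarrow> 'b) \<Rightarrow> nat \<Rightarrow> 'a set set"
  where "data_cells X x N = (\<lambda>i. X -` {x i}) ` {1..N}"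

definition rest_cell :: "('a \<Rightarrow> 'b) \<Rightarrow> (nat \<Rightarrow> 'b) \<Rightarrow> nat \<Rightarrow> 'a set"
  where "rest_cell X x N = UNIV - \<Union> (data_cells X x N)"

definition partition_cells :: "('a \<Rightarrow> 'b) \<Rightarrow> (nat \<Rightarrow> 'b) \<Rightarrow> nat \<Rightarrow> 'a set set"
  where "partition_cells X x N = insert (rest_cell X x N) (data_cells X x N)"

definition data_count :: "('a \<Rightarrow> 'b) \<Rightarrow> (nat \<Rightarrow> 'b) \<Rightarrow> nat \<Rightarrow> 'a set \<Rightarrow> nat"
  where "data_count X x N E = card {i \<in> {1..N}. X -` {x i} = E}"

text \<open>Only the values on \<^term>\<open>partition_cells X x N\<close> are meaningful.\<close>

definition P_emp :: "('a \<Rightarrow> 'b) \<Rightarrow> (nat \<Rightarrow> 'b) \<Rightarrow> nat \<Rightarrow> 'a set \<Rightarrow> real"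
  where "P_emp X x N E =
    (if rest_cell X x N \<noteq> {} then
       if E \<in> data_cells X x N then real (data_count X x N E) / (real N + 1)
       else 1 - (\<Sum>F\<in>data_cells X x N. real (data_count X x N F) / (real N + 1))
     else
       if E \<in> data_cells X x N then real (data_count X x N E) / real N else 0)"

text \<open>
  Empty cells contribute nothing to the sums over a partition, hence they are removed from the
  index set.
\<close>

definition dpk_update ::
  "('a \<Rightarrow> 'b) \<Rightarrow> (nat \<Rightarrow> 'b) \<Rightarrow> (nat \<Rightarrow> real) \<Rightarrow> nat \<Rightarrow> ('a set \<Rightarrow> real) \<Rightarrow> 'a set \<Rightarrow> real"
  where "dpk_update X x \<beta> N P A =
    (\<Sum>E\<in>partition_cells X x N - {{}}.
       P (A \<inter> E) / P E * (\<beta> N * P E + (1 - \<beta> N) * P_emp X x N E))"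

fun dipk_points ::
  "('a \<Rightarrow> 'b) \<Rightarrow> (nat \<Rightarrow> 'b) \<Rightarrow> (nat \<Rightarrow> nat) \<Rightarrow> (nat \<Rightarrow> real) \<Rightarrow> ('a set \<Rightarrow> real) set \<Rightarrow> nat
    \<Rightarrow> ('a set \<Rightarrow> real) set"
  where
    "dipk_points X x n \<beta> \<P> 0 = {P. P extreme_point_of core (lower_prob \<P>)}"
  | "dipk_points X x n \<beta> \<P> (Suc t) = dpk_update X x \<beta> (n (Suc t)) ` dipk_points X x n \<beta> \<P> t"

fun dipk_belief ::
  "('a \<Rightarrow> 'b) \<Rightarrow> (nat \<Rightarrow> 'b) \<Rightarrow> (nat \<Rightarrow> nat) \<Rightarrow> (nat \<Rightarrow> real) \<Rightarrow> ('a set \<Rightarrow> real) set \<Rightarrow> nat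
    \<Rightarrow> ('a set \<Rightarrow> real) set"
  where
    "dipk_belief X x n \<beta> \<P> 0 = core (lower_prob \<P>)"
  | "dipk_belief X x n \<beta> \<P> (Suc t) = convex hull (dipk_points X x n \<beta> \<P> (Suc t))"

definition dipk_contracts :: "('a set \<Rightarrow> real) set \<Rightarrow> ('a set \<Rightarrow> real) set \<Rightarrow> 'a set \<Rightarrow> bool"
  where "dipk_contracts S' S A \<longleftrightarrow>
    lower_prob S' A \<ge> lower_prob S A \<and> upper_prob S' A \<le> upper_prob S A \<and>
    (lower_prob S' A > lower_prob S A \<or> upper_prob S' A < upper_prob S A)"

end

theory Submission
  imports Defs
begin

text \<open>
  The DPK update of a measure \<open>P\<close> assigns to \<open>A\<close> a sum over the nonempty cells \<open>E\<close> of products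
  of the conditional probability \<open>P (A \<inter> E) / P E\<close> and the revised cell weight
  \<open>\<beta> N * P E + (1 - \<beta> N) * P_emp X x N E\<close>. For \<open>P\<close> in the old belief set, the first factor lies
  between the generalized Bayes lower and upper conditional probabilities, and the second between
  the weights formed with the lower and the upper probability of \<open>E\<close>. All of these factors are
  nonnegative, so the products, and hence the update at \<open>A\<close>, lie between the two sums of
  the theorem (\<open>dpk_update_ge\<close> and \<open>dpk_update_le\<close>). The new belief set is the convex hull of such
  updates, and the values at \<open>A\<close> over a convex hull stay within bounds that are valid at its
  generators. Both bounds therefore hold for the new lower and upper probability of \<open>A\<close>, and the
  assumed inequalities, one of them strict, compare them with the old ones.

  What needs care is that every infimum and supremum is taken over a nonempty set that is bounded
  on the relevant side. This is controlled by a property weaker than being a probability measure: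
  being nonnegative and monotone in the event. It makes the conditional probabilities lie
  in \<open>{0..1}\<close>, it passes to convex hulls, and it is
  preserved by the update because the empirical weights are nonnegative. An upper bound
  on \<open>P E\<close> comes from the finiteness of the set of generators.
\<close>

definition monotone_set_functions :: "('a set \<Rightarrow> real) set"
  where "monotone_set_functions = {P. (\<forall>B. 0 \<le> P B) \<and> mono P}"

lemma monotone_set_functionsI:
  "(\<And>B. 0 \<le> P B) \<Longrightarrow> (\<And>B C. B \<subseteq> C \<Longrightarrow> P B \<le> P C) \<Longrightarrow> P \<in> monotone_set_functions"
  by (auto simp: monotone_set_functions_def mono_def)

lemma monotone_set_functionsD:
  assumes "P \<in> monotone_set_functions"
  shows "0 \<le> P B" and "B \<subseteq> C \<Longrightarrow> P B \<le> P C"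
  using assms by (auto simp: monotone_set_functions_def mono_def)

lemma prob_measures_subset_monotone_set_functions:
  "prob_measures \<subseteq> monotone_set_functions"
proof
  fix P :: "'a set \<Rightarrow> real"
  assume "P \<in> prob_measures"
  then obtain M where M: "prob_space M" "sets M = UNIV" "P = measure M"
    by (auto simp: prob_measures_def)
  then interpret prob_space M
    by simp
  show "P \<in> monotone_set_functions"
    by (rule monotone_set_functionsI) (auto simp: M intro!: finite_measure_mono)
qed

lemma convex_monotone_set_functions: "convex monotone_set_functions"
  by (rule convexI, rule monotone_set_functionsI)
    (auto simp: scaleR_fun_def monotone_set_functionsD intro!: add_mono mult_left_mono)

lemma convex_evaluation_ge: "convex {P :: 'a set \<Rightarrow> real. c \<le> P A}"
proof (rule convexI)
  fix P Q :: "'a set \<Rightarrow> real" and u v :: real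
  assume *: "P \<in> {P. c \<le> P A}" "Q \<in> {P. c \<le> P A}" "0 \<le> u" "0 \<le> v" "u + v = 1"
  then have "u * c + v * c \<le> u * P A + v * Q A"
    by (intro add_mono mult_left_mono) auto
  moreover have "u * c + v * c = c"
    using * by (metis distrib_right mult_1)
  ultimately show "u *\<^sub>R P + v *\<^sub>R Q \<in> {P. c \<le> P A}"
    by (simp add: scaleR_fun_def)
qed

lemma convex_evaluation_le: "convex {P :: 'a set \<Rightarrow> real. P A \<le> c}"
proof (rule convexI)
  fix P Q :: "'a set \<Rightarrow> real" and u v :: real
  assume *: "P \<in> {P. P A \<le> c}" "Q \<in> {P. P A \<le> c}" "0 \<le> u" "0 \<le> v" "u + v = 1"
  then have "u * P A + v * Q A \<le> u * c + v * c"
    by (intro add_mono mult_left_mono) auto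
  moreover have "u * c + v * c = c"
    using * by (metis distrib_right mult_1)
  ultimately show "u *\<^sub>R P + v *\<^sub>R Q \<in> {P. P A \<le> c}"
    by (simp add: scaleR_fun_def)
qed

lemma lower_prob_convex_hull_ge:
  assumes "F \<noteq> {}" and "\<And>P. P \<in> F \<Longrightarrow> c \<le> P A"
  shows "c \<le> lower_prob (convex hull F) A"
proof -
  have "convex hull F \<subseteq> {P. c \<le> P A}"
    by (rule hull_minimal) (use assms(2) convex_evaluation_ge in auto)
  with assms(1) show ?thesis
    unfolding lower_prob_def by (intro cINF_greatest) auto
qed

lemma upper_prob_convex_hull_le:
  assumes "F \<noteq> {}" and "\<And>P. P \<in> F \<Longrightarrow> P A \<le> c"
  shows "upper_prob (convex hull F) A \<le> c"
proof -
  have "convex hull F \<subseteq> {P. P A \<le> c}"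
    by (rule hull_minimal) (use assms(2) convex_evaluation_le in auto)
  with assms(1) show ?thesis
    unfolding upper_prob_def by (intro cSUP_least) auto
qed

lemma bdd_above_evaluation_convex_hull:
  assumes "finite F"
  shows "bdd_above ((\<lambda>P. P A) ` (convex hull F :: ('a set \<Rightarrow> real) set))"
proof -
  obtain c where c: "\<And>P. P \<in> F \<Longrightarrow> P A \<le> c"
    using bdd_above_finite[OF finite_imageI[OF assms, of "\<lambda>P. P A"]]
    by (auto simp: bdd_above_def)
  have "convex hull F \<subseteq> {P. P A \<le> c}"
    by (rule hull_minimal) (use c convex_evaluation_le in auto)
  then show ?thesis
    by (auto simp: bdd_above_def)
qed

lemma lower_prob_le:
  assumes "S \<subseteq> monotone_set_functions" and "P \<in> S"
  shows "lower_prob S A \<le> P A"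
  unfolding lower_prob_def
  by (rule cINF_lower)
    (use assms in \<open>auto simp: bdd_below_def dest: monotone_set_functionsD intro!: exI[of _ 0]\<close>)

lemma lower_prob_nonneg:
  assumes "S \<subseteq> monotone_set_functions" and "S \<noteq> {}"
  shows "0 \<le> lower_prob S A"
  unfolding lower_prob_def
  by (rule cINF_greatest) (use assms in \<open>auto dest: monotone_set_functionsD\<close>)

lemma upper_prob_ge:
  assumes "bdd_above ((\<lambda>P. P A) ` S)" and "P \<in> S"
  shows "P A \<le> upper_prob S A"
  unfolding upper_prob_def using assms by (intro cSUP_upper) auto

text \<open>
  The case \<open>P E = 0\<close> is covered because the quotient is then \<open>0\<close>.
\<close>

lemma conditional_in_unit_interval:
  assumes "P \<in> monotone_set_functions"
  shows "P (A \<inter> E) / P E \<in> {0..1}"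
proof -
  have "P (A \<inter> E) \<le> P E"
    using monotone_set_functionsD(2)[OF assms] by simp
  then show ?thesis
    using monotone_set_functionsD(1)[OF assms, of "A \<inter> E"]
      monotone_set_functionsD(1)[OF assms, of E]
    by (auto simp: divide_le_eq_1)
qed

lemma bayes_lower_le:
  assumes "S \<subseteq> monotone_set_functions" and "P \<in> S"
  shows "bayes_lower S A E \<le> P (A \<inter> E) / P E"
  unfolding bayes_lower_def
proof (rule cINF_lower)
  show "bdd_below ((\<lambda>P. P (A \<inter> E) / P E) ` S)"
    using conditional_in_unit_interval[of _ A E] assms(1) by (intro bdd_belowI[of _ 0]) force
qed (rule assms(2))

lemma bayes_upper_ge:
  assumes "S \<subseteq> monotone_set_functions" and "P \<in> S"
  shows "P (A \<inter> E) / P E \<le> bayes_upper S A E"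
  unfolding bayes_upper_def
proof (rule cSUP_upper)
  show "bdd_above ((\<lambda>P. P (A \<inter> E) / P E) ` S)"
    using conditional_in_unit_interval[of _ A E] assms(1) by (intro bdd_aboveI[of _ 1]) force
qed (rule assms(2))

text \<open>
  Each observation is counted in exactly one of the distinct data cells, so their frequencies with
  denominator \<open>N + 1\<close> sum to \<open>N / (N + 1) \<le> 1\<close>, and the mass left over for the cell of
  unobserved outcomes is not negative.
\<close>

lemma P_emp_nonneg: "0 \<le> P_emp X x N E"
proof -
  have "(\<Sum>F\<in>data_cells X x N. data_count X x N F) = card {1..N}"
    unfolding data_count_def data_cells_def
    using sum.image_gen[of "{1..N}" "\<lambda>_. 1 :: nat" "\<lambda>i. X -` {x i}"] by simp
  then have "(\<Sum>F\<in>data_cells X x N. real (data_count X x N F)) = real N"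
    by (metis card_atLeastAtMost diff_Suc_1 of_nat_sum)
  then have "(\<Sum>F\<in>data_cells X x N. real (data_count X x N F) / (real N + 1)) \<le> 1"
    by (simp flip: sum_divide_distrib)
  then show ?thesis
    by (auto simp: P_emp_def)
qed

text \<open>
  For a fixed \<open>P\<close>, the update is a combination of the maps \<open>A \<mapsto> P (A \<inter> E)\<close> with nonnegative
  coefficients.
\<close>

lemma dpk_update_monotone_set_functions:
  assumes P: "P \<in> monotone_set_functions" and \<beta>: "\<beta> N \<in> {0..1}"
  shows "dpk_update X x \<beta> N P \<in> monotone_set_functions"
proof (rule monotone_set_functionsI)
  have weight: "0 \<le> \<beta> N * P E + (1 - \<beta> N) * P_emp X x N E" for E
    using \<beta> P_emp_nonneg[of X x N E] monotone_set_functionsD(1)[OF P, of E] by simp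
  show "0 \<le> dpk_update X x \<beta> N P B" for B
    unfolding dpk_update_def using weight monotone_set_functionsD(1)[OF P]
    by (intro sum_nonneg mult_nonneg_nonneg divide_nonneg_nonneg)
  show "dpk_update X x \<beta> N P B \<le> dpk_update X x \<beta> N P C" if "B \<subseteq> C" for B C
    unfolding dpk_update_def using weight that
    by (intro sum_mono mult_right_mono divide_right_mono monotone_set_functionsD[OF P]) auto
qed

lemma dpk_update_ge:
  assumes S: "S \<subseteq> monotone_set_functions" and P: "P \<in> S" and \<beta>: "\<beta> N \<in> {0..1}"
  shows "(\<Sum>E\<in>partition_cells X x N - {{}}.
      bayes_lower S A E * (\<beta> N * lower_prob S E + (1 - \<beta> N) * P_emp X x N E))
    \<le> dpk_update X x \<beta> N P A"
  unfolding dpk_update_def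
proof (rule sum_mono)
  fix E
  have "0 \<le> lower_prob S E"
    using lower_prob_nonneg[OF S] P by blast
  then have nonneg: "0 \<le> \<beta> N * lower_prob S E + (1 - \<beta> N) * P_emp X x N E"
    using \<beta> P_emp_nonneg[of X x N E] by simp
  have "\<beta> N * lower_prob S E \<le> \<beta> N * P E"
    using \<beta> lower_prob_le[OF S P] by (simp add: mult_left_mono)
  moreover have "0 \<le> P (A \<inter> E) / P E"
    using conditional_in_unit_interval[of P A E] S P by auto
  ultimately show "bayes_lower S A E * (\<beta> N * lower_prob S E + (1 - \<beta> N) * P_emp X x N E)
      \<le> P (A \<inter> E) / P E * (\<beta> N * P E + (1 - \<beta> N) * P_emp X x N E)"
    by (intro mult_mono bayes_lower_le[OF S P] nonneg) auto
qed

lemma dpk_update_le: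
  assumes S: "S \<subseteq> monotone_set_functions" and P: "P \<in> S" and \<beta>: "\<beta> N \<in> {0..1}"
    and bdd: "\<And>E. bdd_above ((\<lambda>P. P E) ` S)"
  shows "dpk_update X x \<beta> N P A
    \<le> (\<Sum>E\<in>partition_cells X x N - {{}}.
      bayes_upper S A E * (\<beta> N * upper_prob S E + (1 - \<beta> N) * P_emp X x N E))"
  unfolding dpk_update_def
proof (rule sum_mono)
  fix E
  have "0 \<le> P E"
    using monotone_set_functionsD(1) S P by blast
  then have nonneg: "0 \<le> \<beta> N * P E + (1 - \<beta> N) * P_emp X x N E"
    using \<beta> P_emp_nonneg[of X x N E] by simp
  have "\<beta> N * P E \<le> \<beta> N * upper_prob S E"
    using \<beta> upper_prob_ge[OF bdd P] by (simp add: mult_left_mono)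
  moreover have "0 \<le> bayes_upper S A E"
    using conditional_in_unit_interval[of P A E] bayes_upper_ge[OF S P, of A E] S P by force
  ultimately show "P (A \<inter> E) / P E * (\<beta> N * P E + (1 - \<beta> N) * P_emp X x N E)
      \<le> bayes_upper S A E * (\<beta> N * upper_prob S E + (1 - \<beta> N) * P_emp X x N E)"
    by (intro mult_mono bayes_upper_ge[OF S P] nonneg) auto
qed

lemma subset_core_lower_prob:
  assumes "\<P> \<subseteq> prob_measures"
  shows "\<P> \<subseteq> core (lower_prob \<P>)"
  using assms prob_measures_subset_monotone_set_functions
  by (auto simp: core_def intro!: lower_prob_le)

lemma finite_dipk_points:
  assumes "finite {P. P extreme_point_of core (lower_prob \<P>)}"
  shows "finite (dipk_points X x n \<beta> \<P> t)"
  using assms by (induction t) auto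

lemma dipk_points_nonempty:
  assumes "\<P> \<subseteq> prob_measures" and "\<P> \<noteq> {}"
    and "core (lower_prob \<P>) = convex hull {P. P extreme_point_of core (lower_prob \<P>)}"
  shows "dipk_points X x n \<beta> \<P> t \<noteq> {}"
proof (induction t)
  case 0
  have "convex hull {P. P extreme_point_of core (lower_prob \<P>)} \<noteq> {}"
    using subset_core_lower_prob[OF assms(1)] assms(2,3) by auto
  then show ?case
    by (simp only: convex_hull_eq_empty dipk_points.simps not_False_eq_True)
qed simp

lemma dipk_points_monotone_set_functions:
  assumes "strict_mono n" and "\<And>k. k \<ge> 1 \<Longrightarrow> \<beta> k \<in> {0..1}"
  shows "dipk_points X x n \<beta> \<P> t \<subseteq> monotone_set_functions"
proof (induction t)
  case 0
  then show ?case
    using prob_measures_subset_monotone_set_functions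
    by (auto simp: extreme_point_of_def core_def)
next
  case (Suc t)
  have "n (Suc t) \<ge> 1"
    using strict_mono_less[OF assms(1), of t "Suc t"] by simp
  then show ?case
    using Suc assms(2) by (auto intro!: dpk_update_monotone_set_functions)
qed

theorem proposition21:
  fixes X :: "'a::countable \<Rightarrow> 'b"
    and x :: "nat \<Rightarrow> 'b"
    and n :: "nat \<Rightarrow> nat"
    and \<beta> :: "nat \<Rightarrow> real"
    and \<P> :: "('a set \<Rightarrow> real) set"
    and t :: nat
    and A :: "'a set"
  defines "N \<equiv> n t"
    and "cells \<equiv> partition_cells X x (n t) - {{}}"
    and "old \<equiv> dipk_belief X x n \<beta> \<P> (t - 1)"
    and "new \<equiv> dipk_belief X x n \<beta> \<P> t"
  assumes "\<And>i. i \<ge> 1 \<Longrightarrow> x i \<in> range X"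
    and "n 0 = 0" and "strict_mono n"
    and "\<And>k. k \<ge> 1 \<Longrightarrow> \<beta> k \<in> {0..1}"
    and "\<P> \<subseteq> prob_measures" and "\<P> \<noteq> {}"
    and "finite {P. P extreme_point_of core (lower_prob \<P>)}"
    and "core (lower_prob \<P>) = convex hull {P. P extreme_point_of core (lower_prob \<P>)}"
    and "\<And>P B. P extreme_point_of core (lower_prob \<P>) \<Longrightarrow> B \<noteq> {} \<Longrightarrow> P B > 0"
    and "t \<ge> 1"
    and "(\<Sum>E\<in>cells. bayes_lower old A E * (\<beta> N * lower_prob old E + (1 - \<beta> N) * P_emp X x N E))
           \<ge> lower_prob old A"
    and "(\<Sum>E\<in>cells. bayes_upper old A E * (\<beta> N * upper_prob old E + (1 - \<beta> N) * P_emp X x N E))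
           \<le> upper_prob old A"
    and "(\<Sum>E\<in>cells. bayes_lower old A E * (\<beta> N * lower_prob old E + (1 - \<beta> N) * P_emp X x N E))
           > lower_prob old A \<or>
         (\<Sum>E\<in>cells. bayes_upper old A E * (\<beta> N * upper_prob old E + (1 - \<beta> N) * P_emp X x N E))
           < upper_prob old A"
  shows "dipk_contracts new old A"
proof -
  obtain s where t: "t = Suc s"
    using \<open>t \<ge> 1\<close> by (cases t) auto
  define F where "F = dipk_points X x n \<beta> \<P> s"
  have F: "finite F" "F \<noteq> {}" "F \<subseteq> monotone_set_functions"
    unfolding F_def
    using finite_dipk_points dipk_points_nonempty dipk_points_monotone_set_functions assms
    by (blast, blast, metis)
  \<comment> \<open>At time \<open>0\<close> this is the assumption on the core; later it is how belief sets are formed.\<close>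
  have old: "old = convex hull F"
    using assms by (cases s) (simp_all add: F_def old_def t)
  have new: "new = convex hull (dpk_update X x \<beta> N ` F)"
    by (simp add: new_def F_def t N_def)
  have mono: "old \<subseteq> monotone_set_functions"
    unfolding old by (rule hull_minimal) (use F(3) convex_monotone_set_functions in auto)
  have sub: "F \<subseteq> old"
    unfolding old by (rule hull_subset)
  have bdd: "bdd_above ((\<lambda>P. P E) ` old)" for E
    unfolding old by (rule bdd_above_evaluation_convex_hull[OF F(1)])
  have "N \<ge> 1"
    using strict_mono_less[OF \<open>strict_mono n\<close>, of s t] by (simp add: N_def t)
  then have \<beta>: "\<beta> N \<in> {0..1}"
    using assms by blast
  let ?lo = "\<Sum>E\<in>cells. bayes_lower old A E * (\<beta> N * lower_prob old E + (1 - \<beta> N) * P_emp X x N E)"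
  let ?hi = "\<Sum>E\<in>cells. bayes_upper old A E * (\<beta> N * upper_prob old E + (1 - \<beta> N) * P_emp X x N E)"
  have bounds: "?lo \<le> dpk_update X x \<beta> N P A" "dpk_update X x \<beta> N P A \<le> ?hi" if "P \<in> F" for P
    using that sub dpk_update_ge[of old P \<beta> N A X x] dpk_update_le[of old P \<beta> N X x A] mono \<beta> bdd
    by (simp_all add: subset_iff cells_def N_def)
  have "?lo \<le> lower_prob new A"
    unfolding new by (rule lower_prob_convex_hull_ge) (use F(2) bounds(1) in blast)+
  moreover have "upper_prob new A \<le> ?hi"
    unfolding new by (rule upper_prob_convex_hull_le) (use F(2) bounds(2) in blast)+
  ultimately show ?thesis
    unfolding dipk_contracts_def using assms by linarith
qed

end
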